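(* Let $A$ be a commutative multiplicative hyperring with identity element $1$ which is not a local multiplicative hyperring, let $P$ be a strong $\mathcal{C}$-hyperideal of $A$, and let $u,v\in\mathbb{N}$ with $u>v\geq 2$. Then $P$ is a $(u,v)$-absorbing primary hyperideal of $A$ if and only if $P$ is a primary hyperideal of $A$.
   Context: $\mathbb{N}$ is the set of positive integers. A commutative multiplicative hyperring $(A,+,\circ)$ consists of an abelian group $(A,+)$ and a map $\circ$ from $A\times A$ to the nonempty subsets of $A$ which is associative ($\bigcup_{a\in y\circ z} x\circ a=\bigcup_{b\in x\circ y} b\circ z$), commutative ($x\circ y=y\circ x$), satisfies $(-x)\circ y=x\circ(-y)=-(x\circ y)$, and $(y+z)\circ x\subseteq y\circ x+z\circ x$, $x\circ(y+z)\subseteq x\circ y+x\circ z$. For subsets $B,C\subseteq A$, $B\circ C=\bigcup_{b\in B,c\in C} b\circ c$ and $B+C=\{b+c: b\in B, c\in C\}$; an iterated product $x_1\circ\cdots\circ x_n$ is a subset of $A$ (for $n=1$ it is $\{x_1\}$), also written $\bigcirc_{i=1}^n x_i$. An identity element $1$ satisfies $a\in 1\circ a$ for all $a\in A$. $x\in A$ is a unit if $1\in y\circ x$ for some $y\in A$; $U(A)$ is the set of units. A hyperideal is a nonempty subset $B\subseteq A$ with $x-y\in B$ for all $x,y\in B$ and $r\circ x\subseteq B$ for all $x\in B$, $r\in A$; it is proper if $B\ne A$. A proper hyperideal $B$ is maximal if the only hyperideal of $A$ strictly containing $B$ is $A$; $A$ is local if it has exactly one maximal hyperideal. A proper hyperideal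 $B$ is prime if $x\circ y\subseteq B$ ($x,y\in A$) implies $x\in B$ or $y\in B$. $rad(B)$ is the intersection of all prime hyperideals of $A$ containing $B$ (and $rad(B)=A$ if there are none). A proper hyperideal $B$ is primary if $x\circ y\subseteq B$ ($x,y\in A$) implies $x\in B$ or $y\in rad(B)$. A hyperideal $B$ is a strong $\mathcal{C}$-hyperideal if for all $n,k_1,\dots,k_n\in\mathbb{N}$ and $x_{ij}\in A$, $\sum_{i=1}^n\bigl(\bigcirc_{j=1}^{k_i} x_{ij}\bigr)\cap B\neq\varnothing$ implies $\sum_{i=1}^n\bigl(\bigcirc_{j=1}^{k_i} x_{ij}\bigr)\subseteq B$. For $u,v\in\mathbb{N}$ with $u>v$, a proper hyperideal $P$ is $(u,v)$-absorbing primary if whenever $x_1,\dots,x_u\in A\setminus U(A)$ and $x_1\circ\cdots\circ x_u\subseteq P$, then $x_1\circ\cdots\circ x_v\subseteq P$ or $x_{v+1}\circ\cdots\circ x_u\subseteq rad(P)$. *)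

theory Defs
  imports Main "HOL-Library.Set_Algebras"
begin

text \<open>
  The underlying set of a hyperring is the whole type. Finite sums of subsets are the elementwise
  ones of \<^theory>\<open>HOL-Library.Set_Algebras\<close>.
\<close>

class comm_mult_hyperring = ab_group_add +
  fixes hmult :: "'a \<Rightarrow> 'a \<Rightarrow> 'a set"  (infixl "\<odot>" 70)
  assumes hmult_nonempty: "x \<odot> y \<noteq> {}"
    and hmult_assoc: "(\<Union>a \<in> y \<odot> z. x \<odot> a) = (\<Union>b \<in> x \<odot> y. b \<odot> z)"
    and hmult_commute: "x \<odot> y = y \<odot> x"
    and hmult_minus_left: "(- x) \<odot> y = uminus ` (x \<odot> y)"
    and hmult_minus_right: "x \<odot> (- y) = uminus ` (x \<odot> y)"
    and hmult_distrib_right: "(y + z) \<odot> x \<subseteq> {b + c | b c. b \<in> y \<odot> x \<and> c \<in> z \<odot> x}"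
    and hmult_distrib_left: "x \<odot> (y + z) \<subseteq> {b + c | b c. b \<in> x \<odot> y \<and> c \<in> x \<odot> z}"

text \<open>
  An identity element is a chosen part of the structure: it need not be unique, and
  the notion of unit refers to it.
\<close>

class comm_mult_hyperring_1 = comm_mult_hyperring + one +
  assumes hmult_one: "a \<in> 1 \<odot> a"

definition set_hmult :: "'a::comm_mult_hyperring set \<Rightarrow> 'a set \<Rightarrow> 'a set"  (infixl "\<odot>\<odot>" 70)
  where "B \<odot>\<odot> C = (\<Union>b \<in> B. \<Union>c \<in> C. b \<odot> c)"

text \<open>
  The iterated product of a nonempty list; the bracketing is immaterial by associativity.
  The value on \<open>[]\<close> is a dummy, and \<open>[]\<close> is excluded wherever the function is used below.
\<close>

fun hprod :: "'a::comm_mult_hyperring list \<Rightarrow> 'a set"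
  where
    "hprod [] = {}"
  | "hprod [x] = {x}"
  | "hprod (x # y # zs) = {x} \<odot>\<odot> hprod (y # zs)"

definition hunits :: "'a::comm_mult_hyperring_1 set"
  where "hunits = {x. \<exists>y. 1 \<in> y \<odot> x}"

definition hyperideal :: "'a::comm_mult_hyperring set \<Rightarrow> bool"
  where "hyperideal B \<longleftrightarrow>
    B \<noteq> {} \<and> (\<forall>x\<in>B. \<forall>y\<in>B. x - y \<in> B) \<and> (\<forall>x\<in>B. \<forall>r. r \<odot> x \<subseteq> B)"

definition proper_hyperideal :: "'a::comm_mult_hyperring set \<Rightarrow> bool"
  where "proper_hyperideal B \<longleftrightarrow> hyperideal B \<and> B \<noteq> UNIV"

definition maximal_hyperideal :: "'a::comm_mult_hyperring set \<Rightarrow> bool"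
  where "maximal_hyperideal B \<longleftrightarrow>
    proper_hyperideal B \<and> (\<forall>C. hyperideal C \<and> B \<subset> C \<longrightarrow> C = UNIV)"

definition local_hyperring :: "'a::comm_mult_hyperring itself \<Rightarrow> bool"
  where "local_hyperring _ \<longleftrightarrow> (\<exists>!M :: 'a set. maximal_hyperideal M)"

definition prime_hyperideal :: "'a::comm_mult_hyperring set \<Rightarrow> bool"
  where "prime_hyperideal B \<longleftrightarrow>
    proper_hyperideal B \<and> (\<forall>x y. x \<odot> y \<subseteq> B \<longrightarrow> x \<in> B \<or> y \<in> B)"

definition hrad :: "'a::comm_mult_hyperring set \<Rightarrow> 'a set"
  where "hrad B = \<Inter> {Q. prime_hyperideal Q \<and> B \<subseteq> Q}"

definition primary_hyperideal :: "'a::comm_mult_hyperring set \<Rightarrow> bool"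
  where "primary_hyperideal B \<longleftrightarrow>
    proper_hyperideal B \<and> (\<forall>x y. x \<odot> y \<subseteq> B \<longrightarrow> x \<in> B \<or> y \<in> hrad B)"

text \<open>
  The family \<open>x\<^sub>i\<^sub>j\<close> (\<open>i \<le> n\<close>, \<open>j \<le> k\<^sub>i\<close>) is given as a nonempty list \<open>xss\<close> of nonempty lists.
\<close>

definition strong_C_hyperideal :: "'a::comm_mult_hyperring set \<Rightarrow> bool"
  where "strong_C_hyperideal B \<longleftrightarrow>
    hyperideal B \<and>
    (\<forall>xss. xss \<noteq> [] \<and> [] \<notin> set xss \<and> (\<Sum>xs\<leftarrow>xss. hprod xs) \<inter> B \<noteq> {}
      \<longrightarrow> (\<Sum>xs\<leftarrow>xss. hprod xs) \<subseteq> B)"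

definition absorbing_primary_hyperideal ::
    "nat \<Rightarrow> nat \<Rightarrow> 'a::comm_mult_hyperring_1 set \<Rightarrow> bool"
  where "absorbing_primary_hyperideal u v P \<longleftrightarrow>
    0 < v \<and> v < u \<and> proper_hyperideal P \<and>
    (\<forall>xs. length xs = u \<and> set xs \<subseteq> - hunits \<and> hprod xs \<subseteq> P
      \<longrightarrow> hprod (take v xs) \<subseteq> P \<or> hprod (drop v xs) \<subseteq> hrad P)"

end

theory Submission
  imports Defs
begin

text \<open>
  If \<open>A\<close> is not local, then \<open>1 = a + b\<close> for elements \<open>a\<close>, \<open>b\<close> of two distinct maximal hyperideals,
  which are nonunits. Now let \<open>P\<close> be absorbing primary, \<open>x \<circ> y \<subseteq> P\<close> and \<open>y \<notin> rad(P)\<close>, where we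
  may assume that \<open>x\<close> and \<open>y\<close> are nonunits. The absorbing property, applied to \<open>x\<close>, any \<open>v - 1\<close>
  nonunits \<open>z\<^sub>i\<close> and \<open>u - v\<close> copies of \<open>y\<close>, gives \<open>x \<circ> z\<^sub>1 \<circ> \<dots> \<circ> z\<^bsub>v-1\<^esub> \<subseteq> P\<close>. Each \<open>z\<^sub>i\<close> can be
  removed in turn: put \<open>a\<close> and \<open>b\<close> in its place and add, because \<open>w \<in> w \<circ> 1 \<subseteq> w \<circ> a + w \<circ> b\<close>. This
  leaves \<open>x \<in> P\<close>.
\<close>

section \<open>Products of sets and iterated products\<close>

lemma set_hmult_singletons [simp]: "{x} \<odot>\<odot> {y} = x \<odot> y"
  by (simp add: set_hmult_def)

lemma set_hmult_mono: "B \<subseteq> B' \<Longrightarrow> C \<subseteq> C' \<Longrightarrow> B \<odot>\<odot> C \<subseteq> B' \<odot>\<odot> C'"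
  unfolding set_hmult_def by blast

lemma set_hmult_commute: "B \<odot>\<odot> C = C \<odot>\<odot> (B :: 'a::comm_mult_hyperring set)"
  unfolding set_hmult_def using hmult_commute by blast

lemma set_hmult_assoc: "(B \<odot>\<odot> C) \<odot>\<odot> D = B \<odot>\<odot> (C \<odot>\<odot> (D :: 'a::comm_mult_hyperring set))"
proof -
  have "(B \<odot>\<odot> C) \<odot>\<odot> D = (\<Union>b\<in>B. \<Union>c\<in>C. \<Union>d\<in>D. \<Union>e\<in>b \<odot> c. e \<odot> d)"
    unfolding set_hmult_def by blast
  also have "\<dots> = (\<Union>b\<in>B. \<Union>c\<in>C. \<Union>d\<in>D. \<Union>e\<in>c \<odot> d. b \<odot> e)"
    by (simp only: hmult_assoc)
  also have "\<dots> = B \<odot>\<odot> (C \<odot>\<odot> D)"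
    unfolding set_hmult_def by blast
  finally show ?thesis .
qed

text \<open>The tail must be nonempty: \<open>hprod [x]\<close> is \<open>{x}\<close>, whereas a
  product with the dummy \<open>hprod [] = {}\<close> is empty.\<close>

lemma hprod_Cons: "xs \<noteq> [] \<Longrightarrow> hprod (x # xs) = {x} \<odot>\<odot> hprod xs"
  by (cases xs) auto

lemma hprod_append:
  "xs \<noteq> [] \<Longrightarrow> ys \<noteq> [] \<Longrightarrow> hprod (xs @ ys) = hprod xs \<odot>\<odot> hprod ys"
proof (induction xs)
  case (Cons x xs)
  then show ?case
    by (cases "xs = []") (simp_all add: hprod_Cons set_hmult_assoc)
qed simp

section \<open>Hyperideals, units and maximality\<close>

lemma set_hmult_subset_hyperideal:
  assumes "hyperideal B" "C \<subseteq> B"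
  shows "C \<odot>\<odot> D \<subseteq> B"
proof -
  have "D \<odot>\<odot> C \<subseteq> B"
    using assms unfolding hyperideal_def set_hmult_def by blast
  then show ?thesis
    by (simp add: set_hmult_commute)
qed

lemma hyperideal_zero: "hyperideal B \<Longrightarrow> 0 \<in> B"
  unfolding hyperideal_def by (metis diff_self ex_in_conv)

lemma hyperideal_add:
  assumes "hyperideal B" "x \<in> B" "y \<in> B"
  shows "x + y \<in> B"
proof -
  have "0 - y \<in> B"
    using assms hyperideal_zero unfolding hyperideal_def by blast
  then have "x - (0 - y) \<in> B"
    using assms unfolding hyperideal_def by blast
  then show ?thesis by simp
qed

text \<open>Distributivity as an inclusion suffices, because \<open>r \<odot> (b + c)\<close> only
  has to lie inside \<open>B + C\<close>.\<close>

lemma hyperideal_plus: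
  assumes "hyperideal B" "hyperideal C"
  shows "hyperideal (B + C)"
  unfolding hyperideal_def
proof (intro conjI ballI allI)
  show "B + C \<noteq> {}"
    using assms hyperideal_zero set_plus_intro by blast
next
  fix x y assume "x \<in> B + C" "y \<in> B + C"
  then obtain b c b' c' where "x = b + c" "y = b' + c'" "b \<in> B" "c \<in> C" "b' \<in> B" "c' \<in> C"
    by (elim set_plus_elim)
  moreover from this have "b - b' \<in> B" "c - c' \<in> C"
    using assms unfolding hyperideal_def by auto
  ultimately show "x - y \<in> B + C"
    using set_plus_intro[of "b - b'" B "c - c'" C] by (simp add: algebra_simps)
next
  fix x r assume "x \<in> B + C"
  then obtain b c where x: "x = b + c" "b \<in> B" "c \<in> C"
    by (elim set_plus_elim)
  then have "r \<odot> b \<subseteq> B" "r \<odot> c \<subseteq> C"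
    using assms unfolding hyperideal_def by auto
  then show "r \<odot> x \<subseteq> B + C"
    unfolding x(1) using hmult_distrib_left[of r b c] by (fastforce intro: set_plus_intro)
qed

lemma hyperideal_eq_UNIV_iff:
  fixes B :: "'a::comm_mult_hyperring_1 set"
  assumes "hyperideal B"
  shows "B = UNIV \<longleftrightarrow> 1 \<in> B"
proof
  assume "1 \<in> B"
  then have "a \<odot> 1 \<subseteq> B" for a
    using assms unfolding hyperideal_def by blast
  then show "B = UNIV"
    using hmult_one hmult_commute by blast
qed simp

text \<open>If \<open>1 \<in> y \<odot> x\<close> with \<open>x \<in> B\<close>, then absorption
  puts \<open>1\<close> into \<open>B\<close>.\<close>

lemma proper_hyperideal_nonunit:
  assumes "proper_hyperideal B" "x \<in> B"
  shows "x \<notin> hunits"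
  using assms hyperideal_eq_UNIV_iff[of B]
  unfolding proper_hyperideal_def hyperideal_def hunits_def by blast

lemma hyperideal_Union_chain:
  assumes "\<And>B. B \<in> \<C> \<Longrightarrow> hyperideal B" "\<C> \<noteq> {}" "subset.chain \<A> \<C>"
  shows "hyperideal (\<Union>\<C>)"
  unfolding hyperideal_def
proof (intro conjI ballI allI)
  show "\<Union>\<C> \<noteq> {}"
    using assms(1,2) hyperideal_zero by blast
next
  fix x y assume "x \<in> \<Union>\<C>" "y \<in> \<Union>\<C>"
  then obtain B C where BC: "B \<in> \<C>" "C \<in> \<C>" "x \<in> B" "y \<in> C" by blast
  then have "B \<subseteq> C \<or> C \<subseteq> B"
    using assms(3) unfolding subset_chain_def by blast
  then show "x - y \<in> \<Union>\<C>"
    using BC assms(1) unfolding hyperideal_def by blast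
next
  fix x r assume "x \<in> \<Union>\<C>"
  then show "r \<odot> x \<subseteq> \<Union>\<C>"
    using assms(1) unfolding hyperideal_def by blast
qed

lemma maximal_hyperideal_exists:
  fixes P :: "'a::comm_mult_hyperring_1 set"
  assumes "proper_hyperideal P"
  obtains M where "maximal_hyperideal M" "P \<subseteq> M"
proof -
  let ?A = "{B. proper_hyperideal B \<and> P \<subseteq> B}"
  have "\<exists>M\<in>?A. \<forall>X\<in>?A. M \<subseteq> X \<longrightarrow> X = M"
  proof (rule subset_Zorn_nonempty)
    show "?A \<noteq> {}" using assms by blast
  next
    fix \<C> assume C: "\<C> \<noteq> {}" "subset.chain ?A \<C>"
    then have sub: "\<C> \<subseteq> ?A"
      unfolding subset_chain_def by blast
    then have "hyperideal (\<Union>\<C>)"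
      using hyperideal_Union_chain[OF _ C] unfolding proper_hyperideal_def by blast
    \<comment> \<open>Properness survives the union of a chain because it amounts to avoiding the
      single element \<open>1\<close>.\<close>
    moreover have "1 \<notin> B" if "B \<in> \<C>" for B
      using sub that hyperideal_eq_UNIV_iff[of B] unfolding proper_hyperideal_def by auto
    then have "\<Union>\<C> \<noteq> UNIV" by auto
    ultimately show "\<Union>\<C> \<in> ?A"
      using sub C(1) unfolding proper_hyperideal_def by auto
  qed
  then obtain M where "M \<in> ?A" and max: "\<forall>X\<in>?A. M \<subseteq> X \<longrightarrow> X = M"
    by (elim bexE)
  then have M: "proper_hyperideal M" "P \<subseteq> M" by auto
  have "maximal_hyperideal M"
    unfolding maximal_hyperideal_def
  proof (intro conjI allI impI)
    fix C assume "hyperideal C \<and> M \<subset> C"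
    then show "C = UNIV"
      using M(2) max[rule_format, of C] unfolding proper_hyperideal_def by auto
  qed (fact M)
  from this M(2) show thesis by (rule that)
qed

text \<open>Failing to be local could also mean having no maximal hyperideal at all. The proper
  hyperideal \<open>P\<close> lies in one, so there must be a second.\<close>

lemma not_local_one_eq_sum_nonunits:
  fixes P :: "'a::comm_mult_hyperring_1 set"
  assumes "\<not> local_hyperring TYPE('a)" "proper_hyperideal P"
  obtains a b :: 'a where "1 = a + b" "a \<notin> hunits" "b \<notin> hunits"
proof -
  obtain M :: "'a set" where M: "maximal_hyperideal M"
    using assms(2) by (rule maximal_hyperideal_exists)
  then obtain N :: "'a set" where N: "maximal_hyperideal N" "N \<noteq> M"
    using assms(1) unfolding local_hyperring_def by blast
  have proper: "proper_hyperideal M" "proper_hyperideal N"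
    using M N unfolding maximal_hyperideal_def by auto
  then have hyp: "hyperideal M" "hyperideal N"
    unfolding proper_hyperideal_def by auto
  have "x \<in> M + N" if "x \<in> M" for x
    using set_plus_intro[OF that hyperideal_zero[OF hyp(2)]] by simp
  moreover have "x \<in> M + N" if "x \<in> N" for x
    using set_plus_intro[OF hyperideal_zero[OF hyp(1)] that] by simp
  \<comment> \<open>Otherwise \<open>N \<subset> M\<close>, and maximality of \<open>N\<close> would
    make \<open>M\<close> the whole hyperring.\<close>
  moreover have "\<not> N \<subseteq> M"
    using M N hyp unfolding maximal_hyperideal_def proper_hyperideal_def by blast
  ultimately have "M \<subset> M + N" by blast
  then have "M + N = UNIV"
    using M hyperideal_plus[OF hyp] unfolding maximal_hyperideal_def by blast
  then have "1 \<in> M + N" by blast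
  then obtain a b where "1 = a + b" "a \<in> M" "b \<in> N"
    by (elim set_plus_elim)
  with proper proper_hyperideal_nonunit that show thesis by blast
qed

section \<open>Powers, cancellation and removal of factors\<close>

lemma hprod_replicate_subset_prime:
  assumes "prime_hyperideal Q" "hprod (replicate (Suc n) y) \<subseteq> Q"
  shows "y \<in> Q"
  using assms(2)
proof (induction n)
  case (Suc n)
  show ?case
  proof (rule ccontr)
    assume y: "y \<notin> Q"
    have "{y} \<odot>\<odot> hprod (replicate (Suc n) y) \<subseteq> Q"
      using Suc.prems by simp
    \<comment> \<open>Primeness speaks of elements, so it is applied to \<open>y\<close> and each
      \<open>b\<close> in the smaller power; as \<open>y \<notin> Q\<close>, every such
      \<open>b\<close> lies in \<open>Q\<close>.\<close>
    then have "y \<odot> b \<subseteq> Q" if "b \<in> hprod (replicate (Suc n) y)" for b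
      using that unfolding set_hmult_def by blast
    then have "hprod (replicate (Suc n) y) \<subseteq> Q"
      using y assms(1) unfolding prime_hyperideal_def by blast
    with y Suc.IH show False by blast
  qed
qed simp

text \<open>As \<open>hrad P\<close> is an intersection of prime hyperideals, the case of one prime
  suffices. Positivity of \<open>n\<close> excludes \<open>hprod [] = {}\<close>, which lies in
  every set.\<close>

lemma hprod_replicate_subset_hrad:
  assumes "hprod (replicate n y) \<subseteq> hrad P" "0 < n"
  shows "y \<in> hrad P"
  unfolding hrad_def
proof (intro InterI, clarify)
  fix Q assume Q: "prime_hyperideal Q" "P \<subseteq> Q"
  then have "hprod (replicate (Suc (n - 1)) y) \<subseteq> Q"
    using assms unfolding hrad_def Suc_diff_1[OF assms(2)] by blast
  with Q(1) show "y \<in> Q"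
    by (rule hprod_replicate_subset_prime)
qed

text \<open>With \<open>1 \<in> z \<odot> x\<close>, the element \<open>y \<in> 1 \<odot> y\<close>
  lies in the product of \<open>z\<close>, \<open>x\<close> and \<open>y\<close>, which
  \<open>P\<close> absorbs.\<close>

lemma unit_cancel:
  fixes P :: "'a::comm_mult_hyperring_1 set"
  assumes "hyperideal P" "x \<in> hunits" "x \<odot> y \<subseteq> P"
  shows "y \<in> P"
proof -
  obtain z where z: "1 \<in> z \<odot> x"
    using assms(2) unfolding hunits_def by blast
  have "{1} \<odot>\<odot> {y} \<subseteq> ({z} \<odot>\<odot> {x}) \<odot>\<odot> {y}"
    using z by (intro set_hmult_mono) auto
  also have "\<dots> = ({x} \<odot>\<odot> {y}) \<odot>\<odot> {z}"
    by (metis set_hmult_assoc set_hmult_commute)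
  also have "\<dots> \<subseteq> P"
    using assms by (simp add: set_hmult_subset_hyperideal)
  finally show ?thesis
    using hmult_one[of y] by auto
qed

lemma set_hmult_hprod_replicate_subset:
  assumes "hyperideal P" "x \<odot> y \<subseteq> P" "0 < n"
  shows "{x} \<odot>\<odot> hprod (replicate n y) \<subseteq> P"
\<comment> \<open>For \<open>n = 1\<close>, splitting off one copy of \<open>y\<close> would leave
  the dummy \<open>hprod []\<close>.\<close>
proof (cases "n = 1")
  case False
  with \<open>0 < n\<close> obtain m where "n = Suc (Suc m)"
    by (metis One_nat_def gr0_implies_Suc neq0_conv)
  then have "{x} \<odot>\<odot> hprod (replicate n y) = ({x} \<odot>\<odot> {y}) \<odot>\<odot> hprod (replicate (Suc m) y)"
    by (simp add: set_hmult_assoc del: set_hmult_singletons)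
  also have "\<dots> \<subseteq> P"
    using assms by (simp add: set_hmult_subset_hyperideal)
  finally show ?thesis .
qed (use assms in simp)

lemma hprod_subset_drop_nonunits:
  fixes P :: "'a::comm_mult_hyperring_1 set" and a b :: 'a
  assumes P: "hyperideal P" and ab: "1 = a + b" "a \<notin> hunits" "b \<notin> hunits"
    and "\<And>zs. length zs = k \<Longrightarrow> set zs \<subseteq> - hunits \<Longrightarrow> hprod (x # zs) \<subseteq> P"
  shows "x \<in> P"
  using assms(5)
proof (induction k)
  case 0
  from 0[of "[]"] show ?case by simp
next
  case (Suc k)
  show ?case
  proof (rule Suc.IH)
    fix zs :: "'a list" assume zs: "length zs = k" "set zs \<subseteq> - hunits"
    \<comment> \<open>The factor to be removed is the last one; the fixed head \<open>x\<close>
      keeps the remaining list nonempty, down to \<open>[x]\<close> in the base case.\<close>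
    have *: "hprod (x # zs) \<odot>\<odot> {c} \<subseteq> P" if "c \<notin> hunits" for c
      using Suc.prems[of "zs @ [c]"] zs that hprod_append[of "x # zs" "[c]"] by simp
    show "hprod (x # zs) \<subseteq> P"
    proof
      fix w assume "w \<in> hprod (x # zs)"
      then have "w \<odot> a \<subseteq> P" "w \<odot> b \<subseteq> P"
        using *[OF ab(2)] *[OF ab(3)] unfolding set_hmult_def by auto
      moreover have "w \<in> w \<odot> (a + b)"
        using hmult_one[of w] hmult_commute[of w 1] ab(1) by simp
      ultimately show "w \<in> P"
        using hmult_distrib_left[of w a b] hyperideal_add[OF P] by blast
    qed
  qed
qed

section \<open>The two implications\<close>

lemma primary_imp_absorbing_primary:
  fixes P :: "'a::comm_mult_hyperring_1 set"
  assumes "primary_hyperideal P" "0 < v" "v < u"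
  shows "absorbing_primary_hyperideal u v P"
  unfolding absorbing_primary_hyperideal_def
proof (intro conjI allI impI)
  fix xs :: "'a list"
  assume xs: "length xs = u \<and> set xs \<subseteq> - hunits \<and> hprod xs \<subseteq> P"
  then have "hprod xs = hprod (take v xs) \<odot>\<odot> hprod (drop v xs)"
    using assms hprod_append[of "take v xs" "drop v xs"] by force
  with xs have "b \<odot> c \<subseteq> P" if "b \<in> hprod (take v xs)" "c \<in> hprod (drop v xs)" for b c
    using that unfolding set_hmult_def by blast
  \<comment> \<open>If some \<open>b\<close> lies outside \<open>P\<close>, pairing it with each
    \<open>c\<close> forces the whole second product into \<open>hrad P\<close>.\<close>
  then show "hprod (take v xs) \<subseteq> P \<or> hprod (drop v xs) \<subseteq> hrad P"
    using assms(1) unfolding primary_hyperideal_def by blast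
qed (use assms in \<open>auto simp: primary_hyperideal_def\<close>)

lemma absorbing_primary_imp_primary:
  fixes P :: "'a::comm_mult_hyperring_1 set"
  assumes "\<not> local_hyperring TYPE('a)" "absorbing_primary_hyperideal u v P" "2 \<le> v"
  shows "primary_hyperideal P"
proof -
  have proper: "proper_hyperideal P" and "v < u"
    using assms(2) unfolding absorbing_primary_hyperideal_def by auto
  then have P: "hyperideal P"
    unfolding proper_hyperideal_def by blast
  obtain a b :: 'a where ab: "1 = a + b" "a \<notin> hunits" "b \<notin> hunits"
    using assms(1) proper by (rule not_local_one_eq_sum_nonunits)
  have "x \<in> P" if xy: "x \<odot> y \<subseteq> P" and y: "y \<notin> hrad P" for x y
  proof (cases "y \<in> hunits")
    case True
    then show ?thesis
      using unit_cancel[OF P] xy hmult_commute by metis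
  next
    case y_nonunit: False
    \<comment> \<open>Cancelling a unit \<open>x\<close> would put \<open>y\<close> into
      \<open>P\<close>, hence into every prime hyperideal containing \<open>P\<close>.\<close>
    have x_nonunit: "x \<notin> hunits"
      using unit_cancel[OF P _ xy] y unfolding hrad_def by blast
    show ?thesis
    proof (rule hprod_subset_drop_nonunits[OF P ab])
      fix zs :: "'a list" assume zs: "length zs = v - 1" "set zs \<subseteq> - hunits"
      \<comment> \<open>The cut after \<open>v\<close> entries falls exactly between
        \<open>x # zs\<close> and the copies of \<open>y\<close>.\<close>
      let ?ys = "replicate (u - v) y"
      let ?xs = "(x # zs) @ ?ys"
      \<comment> \<open>Here \<open>2 \<le> v\<close> enters: \<open>zs\<close> has
        \<open>v - 1 > 0\<close> entries, so \<open>hprod zs\<close> is a genuine product.\<close>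
      have ne: "zs \<noteq> []" "?ys \<noteq> []"
        using zs \<open>2 \<le> v\<close> \<open>v < u\<close> by auto
      have len: "length (x # zs) = v"
        using zs \<open>2 \<le> v\<close> by simp
      have "hprod ?xs = ({x} \<odot>\<odot> hprod zs) \<odot>\<odot> hprod ?ys"
        using ne hprod_append[of "x # zs" ?ys] by (simp add: hprod_Cons)
      also have "\<dots> = ({x} \<odot>\<odot> hprod ?ys) \<odot>\<odot> hprod zs"
        by (metis set_hmult_assoc set_hmult_commute)
      also have "\<dots> \<subseteq> P"
        using P xy \<open>v < u\<close>
        by (simp add: set_hmult_subset_hyperideal set_hmult_hprod_replicate_subset)
      finally have "hprod ?xs \<subseteq> P" .
      moreover have "length ?xs = u"
        using len \<open>v < u\<close> by simp
      moreover have "set ?xs \<subseteq> - hunits"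
        using x_nonunit y_nonunit zs by auto
      ultimately have "hprod (take v ?xs) \<subseteq> P \<or> hprod (drop v ?xs) \<subseteq> hrad P"
        using assms(2) unfolding absorbing_primary_hyperideal_def by blast
      moreover have "take v ?xs = x # zs" "drop v ?xs = ?ys"
        unfolding len[symmetric] by simp_all
      ultimately show "hprod (x # zs) \<subseteq> P"
        using hprod_replicate_subset_hrad[of "u - v" y P] y \<open>v < u\<close> by auto
    qed
  qed
  with proper show ?thesis
    unfolding primary_hyperideal_def by blast
qed

theorem theorem2p13:
  fixes P :: "'a::comm_mult_hyperring_1 set" and u v :: nat
  assumes "\<not> local_hyperring TYPE('a)"
    and "strong_C_hyperideal P"
    and "v \<ge> 2" and "u > v"
  shows "absorbing_primary_hyperideal u v P \<longleftrightarrow> primary_hyperideal P"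
proof
  assume "absorbing_primary_hyperideal u v P"
  then show "primary_hyperideal P"
    using assms(1,3) by (intro absorbing_primary_imp_primary)
next
  assume "primary_hyperideal P"
  then show "absorbing_primary_hyperideal u v P"
    using assms(3,4) by (intro primary_imp_absorbing_primary) auto
qed

end
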